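(* Let $\mathbf{X}=(X_1,\ldots,X_N)^T$ be a vector of $N\in\mathbb{N}$ input random variables fulfilling Assumptions A and B (stated in the context). For a general function $y$ with $y(\mathbf{X})\in L^2(\Omega,\mathcal{F},\mathbb{P})$, let $e_{S,m}:=\mathbb{E}[y(\mathbf{X})-y_{S,m}(\mathbf{X})]^2$ and $e_p:=\mathbb{E}[y(\mathbf{X})-y_p(\mathbf{X})]^2$ denote the PDD and PCE errors, where $y_{S,m}(\mathbf{X})$ is the $S$-variate, $m$th-order PDD approximation and $y_p(\mathbf{X})$ the $p$th-order PCE approximation of $y(\mathbf{X})$. Given a truncation parameter $0\le p<\infty$ of the PCE approximation, if the truncation parameters of the PDD approximation are chosen such that $p\wedge N\le S\le N$ and $p\vee S\le m<\infty$, then $$e_{S,m}\le e_p,$$ where $p\wedge N$ denotes the minimum of $p$ and $N$ and $p\vee S$ denotes the maximum of $p$ and $S$.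
   Context: $\mathbb{N}=\{1,2,\ldots\}$, $\mathbb{N}_0=\mathbb{N}\cup\{0\}$; $S,m,p$ are integers. $(\Omega,\mathcal{F},\mathbb{P})$ is a complete probability space with expectation $\mathbb{E}$; $\mathbf{X}$ takes values in $\mathbb{A}^N=\times_{i=1}^N\mathbb{A}^{\{i\}}$, $\mathbb{A}^{\{i\}}\subseteq\mathbb{R}$. $y$ is real-valued and measurable. $\mathbb{E}[Z]^2$ applied to a random difference means $\mathbb{E}[Z^2]$. Assumption A: (1) each $X_i$ has an absolutely continuous marginal distribution function and a continuous marginal density $f_{X_i}$ with bounded or unbounded support $\mathbb{A}^{\{i\}}\subseteq\mathbb{R}$; (2) $X_1,\ldots,X_N$ are statistically independent (not necessarily identically distributed), so $\mathbf{X}$ has joint density $\prod_{i=1}^N f_{X_i}(x_i)$; (3) each $X_i$ has finite moments $\mu_{i,l}=\mathbb{E}[X_i^l]$ of all orders $l\in\mathbb{N}_0$. Assumption B: each $X_i$, $i=1,\ldots,N$, satisfies at least one of: (1) $f_{X_i}$ has compact support, i.e. $\mathbb{P}(a_i\le X_i\le b_i)=1$ for some $a_i,b_i\in\mathbb{R}$; (2) $\liminf_{l\to\infty}(\mu_{i,2l})^{1/2l}/(2l)<\infty$; (3) $\sum_{l\in\mathbb{N}}1/(\mu_{i,2l})^{1/2l}=\infty$; (4) there is a real $a>0$ with $\int_{\mathbb{A}^{\{i\}}}\exp(a|x_i|)f_{X_i}(x_i)dx_i<\infty$; (5) $f_{X_i}$ is symmetric, differentiable and strictly positive, and there is a real $a>0$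 such that $\int_{\mathbb{A}^{\{i\}}}-\frac{\ln f_{X_i}(x_i)}{1+x_i^2}dx_i=\infty$ and $\frac{-x_i\,df_{X_i}(x_i)/dx_i}{f_{X_i}(x_i)}\to\infty$ as $x_i\to\infty$, $x_i\ge a$. For each $i$, $\{P_{\{i\},j}: j\in\mathbb{N}_0\}$ is a set of univariate orthogonal polynomials for $f_{X_i}dx_i$: nonzero real polynomials, $P_{\{i\},j}$ of degree $j$, with $\mathbb{E}[P_{\{i\},j}(X_i)P_{\{i\},k}(X_i)]=0$ for $j\neq k$ and $0<\mathbb{E}[P_{\{i\},j}^2(X_i)]<\infty$; $\Psi_{\{i\},j}=P_{\{i\},j}/\sqrt{\mathbb{E}[P_{\{i\},j}^2(X_i)]}$. For $\emptyset\ne u=\{i_1,\ldots,i_{|u|}\}\subseteq\{1,\ldots,N\}$ and $\mathbf{j}_u=(j_{i_1},\ldots,j_{i_{|u|}})\in\mathbb{N}^{|u|}$ with $|\mathbf{j}_u|=j_{i_1}+\cdots+j_{i_{|u|}}$, $\Psi_{u,\mathbf{j}_u}(\mathbf{x}_u)=\prod_{i\in u}\Psi_{\{i\},j_i}(x_i)$. For $\mathbf{j}=(j_1,\ldots,j_N)\in\mathbb{N}_0^N$ with $|\mathbf{j}|=j_1+\cdots+j_N$, $\Psi_{\mathbf{j}}(\mathbf{x})=\prod_{i=1}^N\Psi_{\{i\},j_i}(x_i)$. PDD (polynomial dimensional decomposition) approximation: $$y_{S,m}(\mathbf{X})=y_\emptyset+\sum_{\substack{\emptyset\neq u\subseteq\{1,\ldots,N\}\\1\le|u|\le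 S}}\ \sum_{\substack{\mathbf{j}_u\in\mathbb{N}^{|u|}\\|u|\le|\mathbf{j}_u|\le m}}C_{u,\mathbf{j}_u}\Psi_{u,\mathbf{j}_u}(\mathbf{X}_u),\quad y_\emptyset=\mathbb{E}[y(\mathbf{X})],\quad C_{u,\mathbf{j}_u}=\mathbb{E}[y(\mathbf{X})\Psi_{u,\mathbf{j}_u}(\mathbf{X}_u)].$$ PCE (polynomial chaos expansion) approximation: $$y_p(\mathbf{X})=\sum_{\substack{\mathbf{j}\in\mathbb{N}_0^N\\0\le|\mathbf{j}|\le p}}C_{\mathbf{j}}\Psi_{\mathbf{j}}(\mathbf{X}),\qquad C_{\mathbf{j}}=\mathbb{E}[y(\mathbf{X})\Psi_{\mathbf{j}}(\mathbf{X})].$$ *)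

theory Defs
  imports "HOL-Probability.Probability"
begin

text \<open>
  The input variables are \<open>X i\<close> for \<open>i \<in> {1..N}\<close>; a point of $\mathbb{R}^N$, the subvector
  indexed by a set \<open>u\<close>, and a multi-index over \<open>u\<close> are extensional functions on \<open>{1..N}\<close>, \<open>u\<close>
  and \<open>u\<close> respectively. All expectations are Lebesgue integrals with respect to \<open>M\<close>.
\<close>

definition input_vector :: "nat \<Rightarrow> (nat \<Rightarrow> 'w \<Rightarrow> real) \<Rightarrow> 'w \<Rightarrow> nat \<Rightarrow> real" where
  "input_vector N X \<omega> = (\<lambda>i\<in>{1..N}. X i \<omega>)"

definition moment :: "'w measure \<Rightarrow> ('w \<Rightarrow> real) \<Rightarrow> nat \<Rightarrow> real" where
  "moment M Z l = (\<integral>\<omega>. Z \<omega> ^ l \<partial>M)"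

text \<open>
  The term ``support'' covers both \<open>{x. f x \<noteq> 0}\<close> and its closure, so that a density such as the
  arcsine density on an open interval as well as the uniform density on a closed interval are
  continuous on their support.
\<close>

definition is_support :: "real set \<Rightarrow> (real \<Rightarrow> real) \<Rightarrow> bool" where
  "is_support S f \<longleftrightarrow> S \<in> sets borel \<and> {x. f x \<noteq> 0} \<subseteq> S \<and> S \<subseteq> closure {x. f x \<noteq> 0}"

text \<open>
  Having the density \<open>f i\<close> with respect to Lebesgue measure is the absolute continuity of the
  distribution function of \<open>X i\<close>. The product form of the joint density is a consequence of
  independence.
\<close>

definition assumption_A ::
  "'w measure \<Rightarrow> nat \<Rightarrow> (nat \<Rightarrow> 'w \<Rightarrow> real) \<Rightarrow> (nat \<Rightarrow> real set) \<Rightarrow> (nat \<Rightarrow> real \<Rightarrow> real) \<Rightarrow> bool" where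
  "assumption_A M N X A f \<longleftrightarrow>
     (\<forall>i\<in>{1..N}. (\<forall>x. 0 \<le> f i x) \<and> distributed M lborel (X i) (\<lambda>x. ennreal (f i x))
        \<and> is_support (A i) (f i) \<and> continuous_on (A i) (f i)
        \<and> (\<forall>\<omega>\<in>space M. X i \<omega> \<in> A i)) \<and>
     prob_space.indep_vars M (\<lambda>_. borel) X {1..N} \<and>
     (\<forall>i\<in>{1..N}. \<forall>l. integrable M (\<lambda>\<omega>. X i \<omega> ^ l))"

definition compact_support_cond :: "'w measure \<Rightarrow> ('w \<Rightarrow> real) \<Rightarrow> bool" where
  "compact_support_cond M Z \<longleftrightarrow>
     (\<exists>a b. measure M {\<omega>\<in>space M. a \<le> Z \<omega> \<and> Z \<omega> \<le> b} = 1)"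

definition liminf_moment_cond :: "'w measure \<Rightarrow> ('w \<Rightarrow> real) \<Rightarrow> bool" where
  "liminf_moment_cond M Z \<longleftrightarrow>
     liminf (\<lambda>l. ereal (root (2 * l) (moment M Z (2 * l)) / real (2 * l))) < \<infinity>"

text \<open>The series over $l \in \{1, 2, \ldots\}$ is indexed by \<open>Suc l\<close>.\<close>

definition carleman_cond :: "'w measure \<Rightarrow> ('w \<Rightarrow> real) \<Rightarrow> bool" where
  "carleman_cond M Z \<longleftrightarrow>
     (\<Sum>l. ennreal (1 / root (2 * Suc l) (moment M Z (2 * Suc l)))) = \<infinity>"

definition exp_integrable_cond :: "real set \<Rightarrow> (real \<Rightarrow> real) \<Rightarrow> bool" where
  "exp_integrable_cond S g \<longleftrightarrow>
     (\<exists>a>0. (\<integral>\<^sup>+x\<in>S. ennreal (exp (a * \<bar>x\<bar>) * g x) \<partial>lborel) < \<infinity>)"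

text \<open>
  The density is viewed as a function on its support \<open>S\<close>, and \<open>g'\<close> is its derivative there. As
  \<open>ennreal\<close> truncates negative numbers to 0, the two integrals are those of the positive and the
  negative part of \<open>- ln (g x) / (1 + x\<^sup>2)\<close>; together they say that its Lebesgue integral is \<open>\<infinity>\<close>.
\<close>

definition krein_lin_cond :: "real set \<Rightarrow> (real \<Rightarrow> real) \<Rightarrow> bool" where
  "krein_lin_cond S g \<longleftrightarrow>
     (\<forall>x\<in>S. - x \<in> S \<and> g (- x) = g x) \<and> (\<forall>x\<in>S. 0 < g x) \<and>
     (\<exists>g' a. (\<forall>x\<in>S. (g has_real_derivative g' x) (at x within S)) \<and> 0 < a \<and>
        (\<integral>\<^sup>+x\<in>S. ennreal (- ln (g x) / (1 + x\<^sup>2)) \<partial>lborel) = \<infinity> \<and>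
        (\<integral>\<^sup>+x\<in>S. ennreal (ln (g x) / (1 + x\<^sup>2)) \<partial>lborel) < \<infinity> \<and>
        filterlim (\<lambda>x. - x * g' x / g x) at_top (inf at_top (principal (S \<inter> {a..}))))"

definition assumption_B ::
  "'w measure \<Rightarrow> nat \<Rightarrow> (nat \<Rightarrow> 'w \<Rightarrow> real) \<Rightarrow> (nat \<Rightarrow> real set) \<Rightarrow> (nat \<Rightarrow> real \<Rightarrow> real) \<Rightarrow> bool" where
  "assumption_B M N X A f \<longleftrightarrow>
     (\<forall>i\<in>{1..N}. compact_support_cond M (X i) \<or> liminf_moment_cond M (X i) \<or>
        carleman_cond M (X i) \<or> exp_integrable_cond (A i) (f i) \<or> krein_lin_cond (A i) (f i))"

definition orthogonal_polys ::
  "'w measure \<Rightarrow> nat \<Rightarrow> (nat \<Rightarrow> 'w \<Rightarrow> real) \<Rightarrow> (nat \<Rightarrow> nat \<Rightarrow> real poly) \<Rightarrow> bool" where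
  "orthogonal_polys M N X P \<longleftrightarrow>
     (\<forall>i\<in>{1..N}.
        (\<forall>j. P i j \<noteq> 0 \<and> degree (P i j) = j
           \<and> integrable M (\<lambda>\<omega>. (poly (P i j) (X i \<omega>))\<^sup>2)
           \<and> 0 < (\<integral>\<omega>. (poly (P i j) (X i \<omega>))\<^sup>2 \<partial>M)) \<and>
        (\<forall>j k. j \<noteq> k \<longrightarrow> (\<integral>\<omega>. poly (P i j) (X i \<omega>) * poly (P i k) (X i \<omega>) \<partial>M) = 0))"

definition Psi1 ::
  "'w measure \<Rightarrow> (nat \<Rightarrow> 'w \<Rightarrow> real) \<Rightarrow> (nat \<Rightarrow> nat \<Rightarrow> real poly) \<Rightarrow> nat \<Rightarrow> nat \<Rightarrow> real \<Rightarrow> real" where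
  "Psi1 M X P i j x = poly (P i j) x / sqrt (\<integral>\<omega>. (poly (P i j) (X i \<omega>))\<^sup>2 \<partial>M)"

text \<open>
  \<open>Psi M X P u j\<close> is $\Psi_{u,\mathbf{j}_u}$; for \<open>u = {1..N}\<close> and \<open>j\<close> with values in $\mathbb{N}_0$
  it is $\Psi_{\mathbf{j}}$. Likewise \<open>coeff_C\<close> gives both $C_{u,\mathbf{j}_u}$ and $C_{\mathbf{j}}$.
\<close>

definition Psi ::
  "'w measure \<Rightarrow> (nat \<Rightarrow> 'w \<Rightarrow> real) \<Rightarrow> (nat \<Rightarrow> nat \<Rightarrow> real poly)
    \<Rightarrow> nat set \<Rightarrow> (nat \<Rightarrow> nat) \<Rightarrow> (nat \<Rightarrow> real) \<Rightarrow> real" where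
  "Psi M X P u j x = (\<Prod>i\<in>u. Psi1 M X P i (j i) (x i))"

definition coeff_C ::
  "'w measure \<Rightarrow> nat \<Rightarrow> (nat \<Rightarrow> 'w \<Rightarrow> real) \<Rightarrow> (nat \<Rightarrow> nat \<Rightarrow> real poly)
    \<Rightarrow> ((nat \<Rightarrow> real) \<Rightarrow> real) \<Rightarrow> nat set \<Rightarrow> (nat \<Rightarrow> nat) \<Rightarrow> real" where
  "coeff_C M N X P y u j =
     (\<integral>\<omega>. y (input_vector N X \<omega>) * Psi M X P u j (restrict (input_vector N X \<omega>) u) \<partial>M)"

definition PDD_index :: "nat set \<Rightarrow> nat \<Rightarrow> (nat \<Rightarrow> nat) set" where
  "PDD_index u m = {j \<in> u \<rightarrow>\<^sub>E {1..}. card u \<le> (\<Sum>i\<in>u. j i) \<and> (\<Sum>i\<in>u. j i) \<le> m}"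

definition PCE_index :: "nat \<Rightarrow> nat \<Rightarrow> (nat \<Rightarrow> nat) set" where
  "PCE_index N p = {j \<in> {1..N} \<rightarrow>\<^sub>E UNIV. (\<Sum>i\<in>{1..N}. j i) \<le> p}"

lemma finite_bounded_multi_indices:
  assumes "finite u"
  shows "finite {j \<in> u \<rightarrow>\<^sub>E B. (\<Sum>i\<in>u. j i) \<le> (m::nat)}"
proof (rule finite_subset)
  show "{j \<in> u \<rightarrow>\<^sub>E B. (\<Sum>i\<in>u. j i) \<le> m} \<subseteq> u \<rightarrow>\<^sub>E {..m}"
  proof
    fix j assume j: "j \<in> {j \<in> u \<rightarrow>\<^sub>E B. (\<Sum>i\<in>u. j i) \<le> m}"
    have "j i \<le> m" if "i \<in> u" for i
      using member_le_sum[OF that, of j] assms j by force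
    with j show "j \<in> u \<rightarrow>\<^sub>E {..m}" by (auto simp: PiE_iff)
  qed
  show "finite (u \<rightarrow>\<^sub>E {..m})" using assms by (simp add: finite_PiE)
qed

lemma finite_PDD_index: "finite u \<Longrightarrow> finite (PDD_index u m)"
  unfolding PDD_index_def
  by (rule finite_subset[OF _ finite_bounded_multi_indices[of u "{1..}" m]]) auto

lemma finite_PCE_index: "finite (PCE_index N p)"
  unfolding PCE_index_def by (rule finite_bounded_multi_indices) simp

definition PDD_approx ::
  "'w measure \<Rightarrow> nat \<Rightarrow> (nat \<Rightarrow> 'w \<Rightarrow> real) \<Rightarrow> (nat \<Rightarrow> nat \<Rightarrow> real poly)
    \<Rightarrow> ((nat \<Rightarrow> real) \<Rightarrow> real) \<Rightarrow> nat \<Rightarrow> nat \<Rightarrow> (nat \<Rightarrow> real) \<Rightarrow> real" where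
  "PDD_approx M N X P y S m x =
     (\<integral>\<omega>. y (input_vector N X \<omega>) \<partial>M) +
     (\<Sum>u\<in>{u. u \<noteq> {} \<and> u \<subseteq> {1..N} \<and> 1 \<le> card u \<and> card u \<le> S}.
        \<Sum>j\<in>PDD_index u m. coeff_C M N X P y u j * Psi M X P u j (restrict x u))"

definition PCE_approx ::
  "'w measure \<Rightarrow> nat \<Rightarrow> (nat \<Rightarrow> 'w \<Rightarrow> real) \<Rightarrow> (nat \<Rightarrow> nat \<Rightarrow> real poly)
    \<Rightarrow> ((nat \<Rightarrow> real) \<Rightarrow> real) \<Rightarrow> nat \<Rightarrow> (nat \<Rightarrow> real) \<Rightarrow> real" where
  "PCE_approx M N X P y p x =
     (\<Sum>j\<in>PCE_index N p. coeff_C M N X P y {1..N} j * Psi M X P {1..N} j x)"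

definition PDD_error ::
  "'w measure \<Rightarrow> nat \<Rightarrow> (nat \<Rightarrow> 'w \<Rightarrow> real) \<Rightarrow> (nat \<Rightarrow> nat \<Rightarrow> real poly)
    \<Rightarrow> ((nat \<Rightarrow> real) \<Rightarrow> real) \<Rightarrow> nat \<Rightarrow> nat \<Rightarrow> real" where
  "PDD_error M N X P y S m =
     (\<integral>\<omega>. (y (input_vector N X \<omega>) - PDD_approx M N X P y S m (input_vector N X \<omega>))\<^sup>2 \<partial>M)"

definition PCE_error ::
  "'w measure \<Rightarrow> nat \<Rightarrow> (nat \<Rightarrow> 'w \<Rightarrow> real) \<Rightarrow> (nat \<Rightarrow> nat \<Rightarrow> real poly)
    \<Rightarrow> ((nat \<Rightarrow> real) \<Rightarrow> real) \<Rightarrow> nat \<Rightarrow> real" where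
  "PCE_error M N X P y p =
     (\<integral>\<omega>. (y (input_vector N X \<omega>) - PCE_approx M N X P y p (input_vector N X \<omega>))\<^sup>2 \<partial>M)"

end

theory Submission
  imports Defs
begin

text \<open>
  Both approximations are truncated Fourier sums of \<open>y(X)\<close> with respect to the same orthonormal
  family, the products \<open>\<Psi>\<^sub>j(X)\<close> with a multi-index \<open>j\<close> over \<open>{1..N}\<close>. This is clear for PCE. For
  PDD, the index pair \<open>(u, j\<^sub>u)\<close> corresponds to the multi-index \<open>j\<close> that extends \<open>j\<^sub>u\<close> by 0; since
  a normalized polynomial of degree 0 is the constant 1 or -1, \<open>\<Psi>\<^sub>u\<^sub>,\<^sub>j\<close> and \<open>\<Psi>\<^sub>j\<close> agree up to a
  sign, and that sign cancels when the function is multiplied by its Fourier coefficient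
  (\<open>fourier_term_support\<close>). Thus PDD keeps exactly the multi-indices of total degree at most \<open>m\<close>
  with at most \<open>S\<close> nonzero entries (\<open>PDD_approx_eq_fourier_sum\<close>).

  Independence makes the family orthonormal (\<open>Psi_orthonormal\<close>), so the mean-square error of a
  Fourier sum over a finite set \<open>J\<close> is the second moment of \<open>y(X)\<close> minus the squared coefficients
  in \<open>J\<close> (\<open>fourier_error\<close>), and a larger set gives a smaller error. A multi-index of total degree
  at most \<open>p\<close> has at most \<open>min p N\<close> nonzero entries, so the PCE indices are among those kept by
  PDD.
\<close>

section \<open>The error of a finite Fourier sum\<close>

lemma integrable_mult_square_integrable:
  fixes f g :: "'a \<Rightarrow> real"
  assumes "f \<in> borel_measurable M" "g \<in> borel_measurable M"
    and "integrable M (\<lambda>x. (f x)\<^sup>2)" "integrable M (\<lambda>x. (g x)\<^sup>2)"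
  shows "integrable M (\<lambda>x. f x * g x)"
proof (rule Bochner_Integration.integrable_bound)
  show "integrable M (\<lambda>x. (f x)\<^sup>2 + (g x)\<^sup>2)"
    using assms by simp
  have "\<bar>a * b\<bar> \<le> a\<^sup>2 + b\<^sup>2" for a b :: real
  proof -
    have "0 \<le> (\<bar>a\<bar> - \<bar>b\<bar>)\<^sup>2" "0 \<le> \<bar>a\<bar> * \<bar>b\<bar>" by simp_all
    then show ?thesis unfolding power2_diff abs_mult power2_abs by linarith
  qed
  then show "AE x in M. norm (f x * g x) \<le> norm ((f x)\<^sup>2 + (g x)\<^sup>2)"
    by simp
qed (use assms in measurable)

lemma fourier_error:
  fixes Y :: "'a \<Rightarrow> real" and \<phi> :: "'b \<Rightarrow> 'a \<Rightarrow> real"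
  assumes J: "finite J"
    and Y: "Y \<in> borel_measurable M" "integrable M (\<lambda>x. (Y x)\<^sup>2)"
    and \<phi>: "\<And>j. j \<in> J \<Longrightarrow> \<phi> j \<in> borel_measurable M"
    and int: "\<And>j k. j \<in> J \<Longrightarrow> k \<in> J \<Longrightarrow> integrable M (\<lambda>x. \<phi> j x * \<phi> k x)"
    and orth: "\<And>j k. j \<in> J \<Longrightarrow> k \<in> J \<Longrightarrow> (\<integral>x. \<phi> j x * \<phi> k x \<partial>M) = (if j = k then 1 else 0)"
  defines "c \<equiv> \<lambda>j. \<integral>x. Y x * \<phi> j x \<partial>M"
  shows "(\<integral>x. (Y x - (\<Sum>j\<in>J. c j * \<phi> j x))\<^sup>2 \<partial>M) = (\<integral>x. (Y x)\<^sup>2 \<partial>M) - (\<Sum>j\<in>J. (c j)\<^sup>2)"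
proof -
  have Y\<phi>: "integrable M (\<lambda>x. Y x * \<phi> j x)" if "j \<in> J" for j
    using integrable_mult_square_integrable[OF Y(1) \<phi>[OF that] Y(2)] int[OF that that]
    by (simp add: power2_eq_square)
  have "(\<integral>x. (Y x - (\<Sum>j\<in>J. c j * \<phi> j x))\<^sup>2 \<partial>M) =
      (\<integral>x. (Y x)\<^sup>2 - 2 * (\<Sum>j\<in>J. c j * (Y x * \<phi> j x))
        + (\<Sum>j\<in>J. \<Sum>k\<in>J. (c j * c k) * (\<phi> j x * \<phi> k x)) \<partial>M)"
  proof (rule Bochner_Integration.integral_cong)
    fix x
    have "(\<Sum>j\<in>J. c j * \<phi> j x)\<^sup>2 = (\<Sum>j\<in>J. \<Sum>k\<in>J. (c j * c k) * (\<phi> j x * \<phi> k x))"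
      unfolding power2_eq_square sum_product by (simp add: mult_ac)
    moreover have "Y x * (\<Sum>j\<in>J. c j * \<phi> j x) = (\<Sum>j\<in>J. c j * (Y x * \<phi> j x))"
      unfolding sum_distrib_left by (simp add: mult_ac)
    ultimately show "(Y x - (\<Sum>j\<in>J. c j * \<phi> j x))\<^sup>2 =
        (Y x)\<^sup>2 - 2 * (\<Sum>j\<in>J. c j * (Y x * \<phi> j x))
          + (\<Sum>j\<in>J. \<Sum>k\<in>J. (c j * c k) * (\<phi> j x * \<phi> k x))"
      by (simp add: power2_diff)
  qed simp
  also have "\<dots> = (\<integral>x. (Y x)\<^sup>2 \<partial>M) - 2 * (\<Sum>j\<in>J. c j * c j)
      + (\<Sum>j\<in>J. \<Sum>k\<in>J. (c j * c k) * (if j = k then 1 else 0))"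
    using Y Y\<phi> int by (simp add: Bochner_Integration.integral_sum orth c_def)
  also have "\<dots> = (\<integral>x. (Y x)\<^sup>2 \<partial>M) - (\<Sum>j\<in>J. (c j)\<^sup>2)"
    using J by (simp add: power2_eq_square if_distrib cong: if_cong)
  finally show ?thesis .
qed

section \<open>Orthonormality of the product polynomials\<close>

context prob_space
begin

context
  fixes N :: nat and X :: "nat \<Rightarrow> 'a \<Rightarrow> real" and P :: "nat \<Rightarrow> nat \<Rightarrow> real poly"
  assumes indep: "indep_vars (\<lambda>_. borel) X {1..N}"
    and polys: "orthogonal_polys M N X P"
begin

lemma random_variable_input [measurable]:
  "i \<in> {1..N} \<Longrightarrow> X i \<in> borel_measurable M"
  using indep by (auto simp: indep_vars_def)

lemma borel_measurable_Psi1 [measurable]: "Psi1 M X P i j \<in> borel_measurable borel"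
proof -
  have [measurable]: "poly q \<in> borel_measurable borel" for q :: "real poly"
    by (intro borel_measurable_continuous_onI continuous_intros)
  show ?thesis
    unfolding Psi1_def by measurable
qed

lemma integrable_Psi1_mult:
  assumes "i \<in> {1..N}"
  shows "integrable M (\<lambda>\<omega>. Psi1 M X P i j (X i \<omega>) * Psi1 M X P i k (X i \<omega>))"
proof -
  have "integrable M (\<lambda>\<omega>. (Psi1 M X P i j (X i \<omega>))\<^sup>2)" for j
    using polys assms by (simp add: orthogonal_polys_def Psi1_def power_divide)
  moreover have "(\<lambda>\<omega>. Psi1 M X P i j (X i \<omega>)) \<in> borel_measurable M" for j
    using assms by measurable
  ultimately show ?thesis
    by (intro integrable_mult_square_integrable)
qed

lemma Psi1_orthonormal:
  assumes "i \<in> {1..N}"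
  shows "(\<integral>\<omega>. Psi1 M X P i j (X i \<omega>) * Psi1 M X P i k (X i \<omega>) \<partial>M) = (if j = k then 1 else 0)"
proof -
  have pos: "0 < (\<integral>\<omega>. (poly (P i j) (X i \<omega>))\<^sup>2 \<partial>M)" for j
    using polys assms by (simp add: orthogonal_polys_def)
  have "j \<noteq> k \<Longrightarrow> (\<integral>\<omega>. poly (P i j) (X i \<omega>) * poly (P i k) (X i \<omega>) \<partial>M) = 0"
    using polys assms by (simp add: orthogonal_polys_def)
  with pos[of j] show ?thesis
    by (auto simp: Psi1_def power2_eq_square)
qed

text \<open>
  The second moment of the constant \<open>P i 0\<close> is its square, so normalization leaves only its sign.
\<close>

lemma Psi1_zero:
  assumes "i \<in> {1..N}"
  obtains s where "s * s = 1" "\<And>x. Psi1 M X P i 0 x = s"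
proof -
  have "P i 0 \<noteq> 0" "degree (P i 0) = 0"
    using polys assms by (simp_all add: orthogonal_polys_def)
  then obtain c where c: "P i 0 = [:c:]" "c \<noteq> 0"
    by (metis degree_eq_zeroE pCons_eq_0_iff)
  show thesis
  proof
    show "sgn c * sgn c = 1"
      using c by (simp add: sgn_if)
    show "Psi1 M X P i 0 x = sgn c" for x
      using c by (simp add: Psi1_def prob_space sgn_if)
  qed
qed

lemma borel_measurable_Psi_input:
  "(\<lambda>\<omega>. Psi M X P {1..N} j (input_vector N X \<omega>)) \<in> borel_measurable M"
proof -
  have "(\<lambda>\<omega>. \<Prod>i\<in>{1..N}. Psi1 M X P i (j i) (X i \<omega>)) \<in> borel_measurable M"
    by measurable
  then show ?thesis
    by (simp add: Psi_def input_vector_def)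
qed

text \<open>
  Independence turns the expectation of a product over the variables into a product of univariate
  expectations, each of which is a Kronecker delta.
\<close>

lemma Psi_orthonormal:
  assumes "j \<in> extensional {1..N}" "k \<in> extensional {1..N}"
  defines "\<psi> \<equiv> \<lambda>j \<omega>. Psi M X P {1..N} j (input_vector N X \<omega>)"
  shows "integrable M (\<lambda>\<omega>. \<psi> j \<omega> * \<psi> k \<omega>)"
    and "(\<integral>\<omega>. \<psi> j \<omega> * \<psi> k \<omega> \<partial>M) = (if j = k then 1 else 0)"
proof -
  define g where "g i \<omega> = Psi1 M X P i (j i) (X i \<omega>) * Psi1 M X P i (k i) (X i \<omega>)" for i \<omega>
  have "indep_vars (\<lambda>_. borel)
      (\<lambda>i. (\<lambda>x. Psi1 M X P i (j i) x * Psi1 M X P i (k i) x) \<circ> X i) {1..N}"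
    by (rule indep_vars_compose[OF indep]) measurable
  then have g: "indep_vars (\<lambda>_. borel) g {1..N}"
    by (simp add: g_def[abs_def] comp_def)
  have int: "integrable M (g i)" if "i \<in> {1..N}" for i
    unfolding g_def by (rule integrable_Psi1_mult[OF that])
  have prod: "\<psi> j \<omega> * \<psi> k \<omega> = (\<Prod>i\<in>{1..N}. g i \<omega>)" for \<omega>
    by (simp add: \<psi>_def g_def Psi_def input_vector_def prod.distrib)
  show "integrable M (\<lambda>\<omega>. \<psi> j \<omega> * \<psi> k \<omega>)"
    unfolding prod by (rule indep_vars_integrable[OF _ g int]) simp_all
  have "(\<integral>\<omega>. \<psi> j \<omega> * \<psi> k \<omega> \<partial>M) = (\<Prod>i\<in>{1..N}. \<integral>\<omega>. g i \<omega> \<partial>M)"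
    unfolding prod by (rule indep_vars_lebesgue_integral[OF _ g int]) simp_all
  also have "\<dots> = (\<Prod>i\<in>{1..N}. if j i = k i then 1 else 0)"
    by (rule prod.cong) (simp_all add: g_def Psi1_orthonormal)
  also have "\<dots> = (if j = k then 1 else 0)"
  proof (cases "j = k")
    case False
    then obtain i where "i \<in> {1..N}" "j i \<noteq> k i"
      using assms(1,2) by (meson extensionalityI)
    then have "(\<Prod>i\<in>{1..N}. if j i = k i then 1 else 0::real) = 0"
      by (intro prod_zero bexI[of _ i]) simp_all
    with False show ?thesis by simp
  qed simp
  finally show "(\<integral>\<omega>. \<psi> j \<omega> * \<psi> k \<omega> \<partial>M) = (if j = k then 1 else 0)" .
qed

section \<open>The PDD approximation as a Fourier sum\<close>

text \<open>
  The factors of \<open>\<Psi>\<^sub>j\<close> outside the support \<open>u\<close> of \<open>j\<close> multiply to a sign \<open>s\<close> that is independent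
  of the point, and \<open>s\<close> enters once through the coefficient and once through the function.
\<close>

lemma fourier_term_support:
  fixes j :: "nat \<Rightarrow> nat" and y :: "(nat \<Rightarrow> real) \<Rightarrow> real"
  defines "u \<equiv> {i\<in>{1..N}. j i \<noteq> 0}"
  shows "coeff_C M N X P y u (restrict j u) * Psi M X P u (restrict j u) (restrict x u)
    = coeff_C M N X P y {1..N} j * Psi M X P {1..N} j x"
proof -
  define s where "s = (\<Prod>i\<in>{1..N} - u. Psi1 M X P i 0 0)"
  have const: "Psi1 M X P i 0 z = Psi1 M X P i 0 0"
    and sq: "Psi1 M X P i 0 0 * Psi1 M X P i 0 0 = 1" if "i \<in> {1..N}" for i z
    using Psi1_zero[OF that] by metis+
  have "s * s = (\<Prod>i\<in>{1..N} - u. Psi1 M X P i 0 0 * Psi1 M X P i 0 0)"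
    by (simp add: s_def prod.distrib)
  also have "\<dots> = 1"
    by (rule prod.neutral) (use sq in auto)
  finally have s: "s * s = 1" .
  have sub: "u \<subseteq> {1..N}"
    by (auto simp: u_def)
  have Psi: "Psi M X P {1..N} j z = s * Psi M X P u (restrict j u) (restrict z u)" for z
  proof -
    have "Psi M X P {1..N} j z =
        (\<Prod>i\<in>{1..N} - u. Psi1 M X P i (j i) (z i)) * (\<Prod>i\<in>u. Psi1 M X P i (j i) (z i))"
      unfolding Psi_def by (rule prod.subset_diff[OF sub]) simp
    also have "(\<Prod>i\<in>{1..N} - u. Psi1 M X P i (j i) (z i)) = s"
      unfolding s_def
    proof (rule prod.cong)
      fix i assume "i \<in> {1..N} - u"
      then have "i \<in> {1..N}" "j i = 0" by (auto simp: u_def)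
      with const[of i "z i"] show "Psi1 M X P i (j i) (z i) = Psi1 M X P i 0 0" by metis
    qed simp
    finally show ?thesis
      by (simp add: Psi_def)
  qed
  have res: "restrict (input_vector N X \<omega>) {1..N} = input_vector N X \<omega>" for \<omega>
    by (simp add: input_vector_def)
  have "coeff_C M N X P y {1..N} j =
      (\<integral>\<omega>. s * (y (input_vector N X \<omega>)
        * Psi M X P u (restrict j u) (restrict (input_vector N X \<omega>) u)) \<partial>M)"
    unfolding coeff_C_def res Psi by (simp add: mult_ac)
  then have "coeff_C M N X P y {1..N} j = s * coeff_C M N X P y u (restrict j u)"
    by (simp add: coeff_C_def)
  then have "coeff_C M N X P y {1..N} j * Psi M X P {1..N} j x =
      (s * s) * (coeff_C M N X P y u (restrict j u) * Psi M X P u (restrict j u) (restrict x u))"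
    unfolding Psi by (simp only: mult_ac)
  then show ?thesis
    using s by simp
qed

text \<open>
  The mean of \<open>y(X)\<close> is the term for \<open>u = {}\<close>, whose only multi-index is the empty one. Then
  the pairs \<open>(u, j\<^sub>u)\<close> with positive entries of \<open>j\<^sub>u\<close> are in bijection with the multi-indices over
  \<open>{1..N}\<close>, where \<open>u\<close> is recovered as the support.
\<close>

lemma PDD_approx_eq_fourier_sum:
  fixes y :: "(nat \<Rightarrow> real) \<Rightarrow> real"
  shows "PDD_approx M N X P y S m x =
    (\<Sum>j\<in>{j \<in> PCE_index N m. card {i\<in>{1..N}. j i \<noteq> 0} \<le> S}.
       coeff_C M N X P y {1..N} j * Psi M X P {1..N} j x)"
proof -
  define T where "T u j = coeff_C M N X P y u j * Psi M X P u j (restrict x u)" for u j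
  define U where "U = {u. u \<subseteq> {1..N} \<and> card u \<le> S}"
  define V where "V = {u. u \<noteq> {} \<and> u \<subseteq> {1..N} \<and> 1 \<le> card u \<and> card u \<le> S}"
  define supp where "supp j = {i\<in>{1..N}. j i \<noteq> 0}" for j :: "nat \<Rightarrow> nat"
  define ext where "ext u j = (\<lambda>i\<in>{1..N}. if i \<in> u then j i else 0)"
    for u and j :: "nat \<Rightarrow> nat"
  have fin: "finite U" "finite V"
    by (auto simp: U_def V_def intro: finite_subset[of _ "Pow {1..N}"])
  have U: "U = insert {} V" "{} \<notin> V"
    by (auto simp: U_def V_def card_gt_0_iff Suc_le_eq intro: finite_subset)
  have "PDD_index {} m = {\<lambda>_. undefined}"
    by (auto simp: PDD_index_def)
  then have "(\<Sum>j\<in>PDD_index {} m. T {} j) = (\<integral>\<omega>. y (input_vector N X \<omega>) \<partial>M)"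
    by (simp add: T_def coeff_C_def Psi_def)
  then have "PDD_approx M N X P y S m x = (\<Sum>u\<in>U. \<Sum>j\<in>PDD_index u m. T u j)"
    using fin U by (simp add: PDD_approx_def T_def V_def)
  also have "\<dots> = (\<Sum>(u, j)\<in>Sigma U (\<lambda>u. PDD_index u m). T u j)"
    using fin(1) by (subst sum.Sigma)
      (auto simp: U_def intro: finite_PDD_index finite_subset)
  also have "\<dots> = (\<Sum>j\<in>{j \<in> PCE_index N m. card (supp j) \<le> S}.
      coeff_C M N X P y {1..N} j * Psi M X P {1..N} j x)"
  proof (rule sum.reindex_bij_witness[where
        i = "\<lambda>j. (supp j, restrict j (supp j))" and j = "\<lambda>(u, j). ext u j"])
    fix a assume "a \<in> Sigma U (\<lambda>u. PDD_index u m)"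
    then obtain u j where a: "a = (u, j)" and u: "u \<subseteq> {1..N}" "card u \<le> S"
      and j: "j \<in> u \<rightarrow>\<^sub>E {1..}" "(\<Sum>i\<in>u. j i) \<le> m"
      by (auto simp: U_def PDD_index_def)
    have supp: "supp (ext u j) = u"
      using u j by (fastforce simp: supp_def ext_def PiE_iff)
    have restr: "restrict (ext u j) u = j"
      using u j by (auto simp: ext_def fun_eq_iff restrict_def PiE_iff extensional_def)
    have "(\<Sum>i\<in>{1..N}. ext u j i) = (\<Sum>i\<in>u. j i)"
      using u by (intro sum.mono_neutral_cong_right) (auto simp: ext_def)
    then show "(case a of (u, j) \<Rightarrow> ext u j) \<in> {j \<in> PCE_index N m. card (supp j) \<le> S}"
      using u j supp by (simp add: a PCE_index_def ext_def)
    show "(supp (case a of (u, j) \<Rightarrow> ext u j),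
        restrict (case a of (u, j) \<Rightarrow> ext u j) (supp (case a of (u, j) \<Rightarrow> ext u j))) = a"
      by (simp add: a supp restr)
    show "coeff_C M N X P y {1..N} (case a of (u, j) \<Rightarrow> ext u j)
        * Psi M X P {1..N} (case a of (u, j) \<Rightarrow> ext u j) x = (case a of (u, j) \<Rightarrow> T u j)"
      using fourier_term_support[of y "ext u j" x, folded supp_def]
      by (simp add: a T_def supp restr)
  next
    fix j assume j: "j \<in> {j \<in> PCE_index N m. card (supp j) \<le> S}"
    then show "(case (supp j, restrict j (supp j)) of (u, j) \<Rightarrow> ext u j) = j"
      by (auto simp: ext_def supp_def PCE_index_def fun_eq_iff PiE_iff extensional_def)
    have sum: "(\<Sum>i\<in>supp j. j i) = (\<Sum>i\<in>{1..N}. j i)"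
      by (intro sum.mono_neutral_left) (auto simp: supp_def)
    have "card (supp j) \<le> (\<Sum>i\<in>supp j. j i)"
      using sum_mono[of "supp j" "\<lambda>_. 1" j] by (auto simp: supp_def Suc_le_eq)
    then show "(supp j, restrict j (supp j)) \<in> Sigma U (\<lambda>u. PDD_index u m)"
      using j sum by (auto simp: U_def PDD_index_def PCE_index_def supp_def Suc_le_eq)
  qed
  finally show ?thesis
    by (simp add: supp_def)
qed

lemma fourier_sum_error:
  fixes y :: "(nat \<Rightarrow> real) \<Rightarrow> real"
  assumes "(\<lambda>\<omega>. y (input_vector N X \<omega>)) \<in> borel_measurable M"
    and "integrable M (\<lambda>\<omega>. (y (input_vector N X \<omega>))\<^sup>2)"
    and "finite J" "J \<subseteq> extensional {1..N}"
  shows "(\<integral>\<omega>. (y (input_vector N X \<omega>) - (\<Sum>j\<in>J. coeff_C M N X P y {1..N} j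
        * Psi M X P {1..N} j (input_vector N X \<omega>)))\<^sup>2 \<partial>M)
    = (\<integral>\<omega>. (y (input_vector N X \<omega>))\<^sup>2 \<partial>M) - (\<Sum>j\<in>J. (coeff_C M N X P y {1..N} j)\<^sup>2)"
proof -
  have "coeff_C M N X P y {1..N} j =
      (\<integral>\<omega>. y (input_vector N X \<omega>) * Psi M X P {1..N} j (input_vector N X \<omega>) \<partial>M)" for j
    by (simp add: coeff_C_def input_vector_def)
  moreover have "j \<in> extensional {1..N}" if "j \<in> J" for j
    using that assms(4) by blast
  ultimately show ?thesis
    using fourier_error[OF assms(3,1,2),
        where \<phi> = "\<lambda>j \<omega>. Psi M X P {1..N} j (input_vector N X \<omega>)",
        OF borel_measurable_Psi_input Psi_orthonormal]
    by presburger
qed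

end

end

section \<open>Comparison of the errors\<close>

theorem proposition6p6:
  fixes M :: "'w measure" and N S m p :: nat
    and X :: "nat \<Rightarrow> 'w \<Rightarrow> real" and A :: "nat \<Rightarrow> real set" and f :: "nat \<Rightarrow> real \<Rightarrow> real"
    and P :: "nat \<Rightarrow> nat \<Rightarrow> real poly" and y :: "(nat \<Rightarrow> real) \<Rightarrow> real"
  assumes "prob_space M" and "complete_measure M"
    and "1 \<le> N"
    and "assumption_A M N X A f" and "assumption_B M N X A f"
    and "orthogonal_polys M N X P"
    and "y \<in> borel_measurable (PiM {1..N} (\<lambda>i. restrict_space borel (A i)))"
    and "integrable M (\<lambda>\<omega>. (y (input_vector N X \<omega>))\<^sup>2)"
    and "min p N \<le> S" and "S \<le> N" and "max p S \<le> m"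
  shows "PDD_error M N X P y S m \<le> PCE_error M N X P y p"
proof -
  interpret prob_space M by fact
  have indep: "indep_vars (\<lambda>_. borel) X {1..N}"
    using assms(4) by (simp add: assumption_A_def)
  have "X i \<in> measurable M (restrict_space borel (A i))" if "i \<in> {1..N}" for i
    using assms(4) that random_variable_input[OF indep assms(6) that]
    by (auto simp: assumption_A_def intro!: measurable_restrict_space2)
  then have "input_vector N X \<in> measurable M (PiM {1..N} (\<lambda>i. restrict_space borel (A i)))"
    unfolding input_vector_def by (rule measurable_restrict)
  then have Y: "(\<lambda>\<omega>. y (input_vector N X \<omega>)) \<in> borel_measurable M"
    using assms(7) by (rule measurable_compose)
  note err = fourier_sum_error[OF indep assms(6) Y assms(8)]
  define J where "J = {j \<in> PCE_index N m. card {i\<in>{1..N}. j i \<noteq> 0} \<le> S}"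
  have fin: "finite J" "finite (PCE_index N p)"
    by (simp_all add: J_def finite_PCE_index)
  have ext: "J \<subseteq> extensional {1..N}" "PCE_index N p \<subseteq> extensional {1..N}"
    by (auto simp: J_def PCE_index_def PiE_iff)
  have sub: "PCE_index N p \<subseteq> J"
  proof
    fix j assume j: "j \<in> PCE_index N p"
    have "card {i\<in>{1..N}. j i \<noteq> 0} \<le> (\<Sum>i\<in>{i\<in>{1..N}. j i \<noteq> 0}. j i)"
      using sum_mono[of "{i\<in>{1..N}. j i \<noteq> 0}" "\<lambda>_. 1" j] by (auto simp: Suc_le_eq)
    also have "\<dots> \<le> (\<Sum>i\<in>{1..N}. j i)"
      by (intro sum_mono2) auto
    also have "\<dots> \<le> p"
      using j by (simp add: PCE_index_def)
    finally have "card {i\<in>{1..N}. j i \<noteq> 0} \<le> p" .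
    moreover have "card {i\<in>{1..N}. j i \<noteq> 0} \<le> card {1..N}"
      by (intro card_mono) auto
    ultimately show "j \<in> J"
      using j assms(9,11) by (simp add: J_def PCE_index_def)
  qed
  have "PDD_error M N X P y S m =
      (\<integral>\<omega>. (y (input_vector N X \<omega>))\<^sup>2 \<partial>M) - (\<Sum>j\<in>J. (coeff_C M N X P y {1..N} j)\<^sup>2)"
    unfolding PDD_error_def PDD_approx_eq_fourier_sum[OF indep assms(6)] J_def[symmetric]
    by (rule err[OF fin(1) ext(1)])
  also have "\<dots> \<le> (\<integral>\<omega>. (y (input_vector N X \<omega>))\<^sup>2 \<partial>M)
      - (\<Sum>j\<in>PCE_index N p. (coeff_C M N X P y {1..N} j)\<^sup>2)"
    by (intro diff_left_mono sum_mono2[OF fin(1) sub]) simp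
  also have "\<dots> = PCE_error M N X P y p"
    unfolding PCE_error_def PCE_approx_def by (rule err[OF fin(2) ext(2), symmetric])
  finally show ?thesis .
qed

end
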